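(* Let $M$ be a homogeneous $1$-manifold. If there is a nonempty open Hausdorff subset $U\subset M$ which is f-rim-simple, then $NH(p)$ is discrete for each $p\in M$.
   Context: A $1$-manifold is a connected topological space each of whose points has a neighborhood homeomorphic to $\mathbb{R}$ (not assumed Hausdorff). A space is homogeneous if for all points $x,y$ there is a self-homeomorphism sending $x$ to $y$. Two points are separated if they have disjoint open neighborhoods; $NH(p)$ is the set of points $y\neq p$ of $M$ which cannot be separated from $p$. Let $U$ be an open Hausdorff subset of $M$ and $p\in\overline{U}\setminus U$. $U$ is f-simple at $p$ if for every open $V\ni p$ there is an open $W\subset V$ containing $p$ such that $W\cap U$ has finitely many connected components. $U$ is f-rim-simple if it is f-simple at each point of $\overline{U}\setminus U$. *)

theory Defs
  imports "HOL-Analysis.Analysis"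
begin

text \<open>The neighborhood \<open>N\<close> need not be open, and Hausdorffness is not required.\<close>

definition one_manifold :: "'a topology \<Rightarrow> bool" where
  "one_manifold X \<longleftrightarrow> connected_space X \<and>
     (\<forall>x \<in> topspace X. \<exists>G N. openin X G \<and> x \<in> G \<and> G \<subseteq> N \<and> N \<subseteq> topspace X \<and>
        subtopology X N homeomorphic_space euclideanreal)"

definition homogeneous_space :: "'a topology \<Rightarrow> bool" where
  "homogeneous_space X \<longleftrightarrow>
     (\<forall>x \<in> topspace X. \<forall>y \<in> topspace X. \<exists>f. homeomorphic_map X X f \<and> f x = y)"

definition separated_points :: "'a topology \<Rightarrow> 'a \<Rightarrow> 'a \<Rightarrow> bool" where
  "separated_points X x y \<longleftrightarrow>
     (\<exists>G H. openin X G \<and> openin X H \<and> x \<in> G \<and> y \<in> H \<and> disjnt G H)"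

definition NH :: "'a topology \<Rightarrow> 'a \<Rightarrow> 'a set" where
  "NH X p = {y \<in> topspace X. y \<noteq> p \<and> \<not> separated_points X p y}"

text \<open>The next two notions are meant for \<open>U\<close> open and Hausdorff in the subspace topology, and
  \<open>f_simple_at\<close> for a point \<open>p\<close> of the closure of \<open>U\<close> outside \<open>U\<close>.\<close>

definition f_simple_at :: "'a topology \<Rightarrow> 'a set \<Rightarrow> 'a \<Rightarrow> bool" where
  "f_simple_at X U p \<longleftrightarrow>
     (\<forall>V. openin X V \<and> p \<in> V \<longrightarrow>
        (\<exists>W. openin X W \<and> W \<subseteq> V \<and> p \<in> W \<and>
             finite (connected_components_of (subtopology X (W \<inter> U)))))"

definition f_rim_simple :: "'a topology \<Rightarrow> 'a set \<Rightarrow> bool" where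
  "f_rim_simple X U \<longleftrightarrow> (\<forall>p \<in> X closure_of U - U. f_simple_at X U p)"

end

theory Submission
  imports Defs
begin

text \<open>
  A point \<open>q\<close> that cannot be separated from a point \<open>u\<close> of the open Hausdorff set \<open>U\<close> lies on the
  rim of \<open>U\<close>: it is in the closure of \<open>U\<close> because each of its neighborhoods meets \<open>U\<close>, and it is
  not in \<open>U\<close> because \<open>U\<close> is Hausdorff. So f-simplicity at \<open>q\<close> gives an open \<open>W\<close> around \<open>q\<close>, inside
  a chart, for which \<open>W \<inter> U\<close> is a finite union of connected sets. Connected subsets of the line
  are intervals, and an interval has at most two limit points outside itself. Hence only finitely
  many rim points lie in \<open>W\<close> (\<open>finite_rim_near\<close>), and as the chart is T1, \<open>W\<close> can be shrunk until it
  contains no point of \<open>NH M u\<close> except \<open>q\<close>. This proves discreteness of \<open>NH M u\<close> for \<open>u \<in> U\<close>.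
  For an arbitrary point \<open>p\<close>, homogeneity gives a homeomorphism that moves \<open>p\<close> to \<open>u\<close>; it carries
  \<open>NH M p\<close> into \<open>NH M u\<close> (\<open>NH_injective_image\<close>), so isolation of points pulls back.
\<close>

text \<open>A limit point outside an interval lies entirely to one side of it, hence is its supremum or
  its infimum.\<close>

lemma finite_closure_minus_connected_real:
  fixes S :: "real set"
  assumes "connected S"
  shows "finite (closure S - S)"
proof -
  have "x = Sup S \<or> x = Inf S" if x: "x \<in> closure S - S" for x
  proof -
    have approx: "\<exists>y\<in>S. dist y x < e" if "e > 0" for e
      using x that by (auto simp: closure_approachable)
    have ne: "S \<noteq> {}"
      using x by auto
    consider "\<forall>y\<in>S. y < x" | "\<forall>y\<in>S. x < y"
      using x connected_contains_Icc[OF assms]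
      by (metis DiffD2 atLeastAtMost_iff linorder_not_le order_le_less subsetD)
    then show ?thesis
    proof cases
      case 1
      have "Sup S = x"
      proof (rule cSup_eq_non_empty[OF ne])
        show "\<And>y. y \<in> S \<Longrightarrow> y \<le> x"
          using 1 by force
        fix b assume b: "\<And>y. y \<in> S \<Longrightarrow> y \<le> b"
        show "x \<le> b"
        proof (rule ccontr)
          assume "\<not> x \<le> b"
          with approx[of "x - b"] b show False
            by (force simp: dist_real_def)
        qed
      qed
      then show ?thesis by simp
    next
      case 2
      have "Inf S = x"
      proof (rule cInf_eq_non_empty[OF ne])
        show "\<And>y. y \<in> S \<Longrightarrow> x \<le> y"
          using 2 by force
        fix b assume b: "\<And>y. y \<in> S \<Longrightarrow> b \<le> y"
        show "b \<le> x"
        proof (rule ccontr)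
          assume "\<not> b \<le> x"
          with approx[of "b - x"] b show False
            by (force simp: dist_real_def)
        qed
      qed
      then show ?thesis by simp
    qed
  qed
  then have "closure S - S \<subseteq> {Sup S, Inf S}"
    by auto
  then show ?thesis
    by (rule finite_subset) simp
qed

lemma finite_closure_of_minus_connectedin_line:
  assumes "X homeomorphic_space euclideanreal" and "connectedin X C"
  shows "finite (X closure_of C - C)"
proof -
  obtain f where f: "homeomorphic_map X euclideanreal f"
    using assms(1) homeomorphic_space by blast
  have C: "C \<subseteq> topspace X"
    using assms(2) by (rule connectedin_subset_topspace)
  have inj: "inj_on f (topspace X)"
    using f by (simp add: homeomorphic_imp_injective_map)
  have "connectedin euclideanreal (f ` C)"
    using homeomorphic_map_connectedness[OF f C] assms(2) by (rule iffD2)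
  then have "finite (closure (f ` C) - f ` C)"
    by (intro finite_closure_minus_connected_real) simp
  moreover have "closure (f ` C) = f ` (X closure_of C)"
    using homeomorphic_map_closure_of[OF f C] by simp
  moreover have "f ` (X closure_of C - C) = f ` (X closure_of C) - f ` C"
    using C closure_of_subset_topspace[of X C] by (intro inj_on_image_set_diff[OF inj]) blast+
  ultimately have "finite (f ` (X closure_of C - C))"
    by simp
  moreover have "inj_on f (X closure_of C - C)"
    using inj by (rule inj_on_subset) (use closure_of_subset_topspace[of X C] in blast)
  ultimately show ?thesis
    by (simp add: finite_image_iff)
qed

text \<open>Closure commutes with finite unions, so a rim point of \<open>U\<close> in \<open>W\<close> is a limit point of one of
  the finitely many components of \<open>W \<inter> U\<close>, each of which is an interval of the chart \<open>N\<close>.\<close>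

lemma finite_rim_near:
  assumes "subtopology X N homeomorphic_space euclideanreal" and "N \<subseteq> topspace X"
    and "openin X W" and "W \<subseteq> N"
    and fin: "finite (connected_components_of (subtopology X (W \<inter> U)))"
  shows "finite (W \<inter> (X closure_of U - U))"
proof -
  let ?K = "connected_components_of (subtopology X (W \<inter> U))"
  let ?Y = "subtopology X N"
  have un: "\<Union> ?K = W \<inter> U"
    using assms(2,4) by (subst Union_connected_components_of) auto
  have "finite (?Y closure_of C - C)" if "C \<in> ?K" for C
  proof -
    have "connectedin X C" "C \<subseteq> N"
      using connectedin_connected_components_of[OF that] assms(4)
      by (auto simp: connectedin_subtopology)
    then show ?thesis
      using assms(1)
      by (intro finite_closure_of_minus_connectedin_line) (auto simp: connectedin_subtopology)
  qed
  with fin have "finite (\<Union>C\<in>?K. ?Y closure_of C - C)"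
    by blast
  moreover have "W \<inter> (X closure_of U - U) \<subseteq> (\<Union>C\<in>?K. ?Y closure_of C - C)"
  proof
    fix y assume y: "y \<in> W \<inter> (X closure_of U - U)"
    then have "y \<in> X closure_of (W \<inter> U)"
      using openin_Int_closure_of_subset[OF assms(3)] by blast
    also have "X closure_of (W \<inter> U) = (\<Union>C\<in>?K. X closure_of C)"
      using closure_of_Union[OF fin, of X] un by simp
    finally obtain C where C: "C \<in> ?K" "y \<in> X closure_of C"
      by blast
    have sub: "C \<subseteq> W \<inter> U"
      using C(1) un by blast
    then have "C \<subseteq> N"
      using assms(4) by blast
    then have "y \<in> ?Y closure_of C"
      using C(2) y assms(4) by (auto simp: closure_of_subtopology Int_absorb1)
    then show "y \<in> (\<Union>C\<in>?K. ?Y closure_of C - C)"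
      using C(1) sub y by blast
  qed
  ultimately show ?thesis
    by (rule finite_subset[rotated])
qed

lemma NH_subset_rim:
  assumes "openin X U" and "Hausdorff_space (subtopology X U)" and "u \<in> U"
  shows "NH X u \<subseteq> X closure_of U - U"
proof
  fix q assume "q \<in> NH X u"
  then have q: "q \<in> topspace X" "q \<noteq> u" "\<not> separated_points X u q"
    by (auto simp: NH_def)
  have "q \<in> X closure_of U"
    using q(1,3) assms(1,3) by (auto simp: in_closure_of separated_points_def disjnt_iff)
  moreover have "q \<notin> U"
  proof
    assume "q \<in> U"
    then obtain G H where "openin (subtopology X U) G" "openin (subtopology X U) H"
        "u \<in> G" "q \<in> H" "disjnt G H"
      using assms(2)[unfolded Hausdorff_space_def, rule_format, of u q] assms(3) q(2)
        topspace_subtopology_subset[OF openin_subset[OF assms(1)]] by auto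
    then have "separated_points X u q"
      unfolding separated_points_def using openin_trans_full[OF _ assms(1)] by blast
    with q(3) show False ..
  qed
  ultimately show "q \<in> X closure_of U - U"
    by simp
qed

lemma isolated_in_NH_of_point_of_f_rim_simple:
  assumes "one_manifold X"
    and "openin X U" and "Hausdorff_space (subtopology X U)" and "f_rim_simple X U"
    and "u \<in> U" and "q \<in> NH X u"
  shows "\<exists>W. openin X W \<and> q \<in> W \<and> W \<inter> NH X u \<subseteq> {q}"
proof -
  have rim: "NH X u \<subseteq> X closure_of U - U"
    using assms by (intro NH_subset_rim)
  have "q \<in> topspace X"
    using assms(6) by (simp add: NH_def)
  then obtain G N where G: "openin X G" "q \<in> G" "G \<subseteq> N" and N: "N \<subseteq> topspace X"
      and line: "subtopology X N homeomorphic_space euclideanreal"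
    using assms(1) unfolding one_manifold_def by blast
  have "f_simple_at X U q"
    using assms(4,6) rim by (auto simp: f_rim_simple_def)
  then obtain W where W: "openin X W" "W \<subseteq> G" "q \<in> W"
      and fin: "finite (connected_components_of (subtopology X (W \<inter> U)))"
    using G unfolding f_simple_at_def by blast
  have "finite (W \<inter> (X closure_of U - U))"
    using line N W G fin by (intro finite_rim_near[of X N]) auto
  then have F: "finite (W \<inter> NH X u - {q})"
    by (rule rev_finite_subset) (use rim in blast)
  \<comment> \<open>The finitely many unwanted points are removed inside the chart, which is Hausdorff although
    the manifold need not be; as \<open>W\<close> is open, what remains is open in the manifold.\<close>
  have "Hausdorff_space (subtopology X N)"
    using homeomorphic_Hausdorff_space[OF line] by simp
  then have "Hausdorff_space (subtopology X W)"
    using Hausdorff_space_subtopology[of "subtopology X N" W] W(2) G(3)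
    by (simp add: subtopology_subtopology Int_absorb1)
  then have "closedin (subtopology X W) (W \<inter> NH X u - {q})"
    using F openin_subset[OF W(1)] by (intro closedin_Hausdorff_finite) auto
  then have "openin (subtopology X W) (W - (W \<inter> NH X u - {q}))"
    using openin_subset[OF W(1)] by (auto simp: closedin_def Int_absorb1)
  then have "openin X (W - (W \<inter> NH X u - {q}))"
    using W(1) openin_trans_full by blast
  then show ?thesis
    using W(3) by (intro exI[of _ "W - (W \<inter> NH X u - {q})"]) auto
qed

text \<open>Preimages of separating neighborhoods are separating neighborhoods.\<close>

lemma NH_injective_image:
  assumes "continuous_map X Y f" and "inj_on f (topspace X)"
    and "p \<in> topspace X" and "y \<in> NH X p"
  shows "f y \<in> NH Y (f p)"
proof -
  have y: "y \<in> topspace X" "y \<noteq> p" "\<not> separated_points X p y"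
    using assms(4) by (auto simp: NH_def)
  have "f y \<in> topspace Y"
    using assms(1) y(1) by (auto simp: continuous_map_def)
  moreover have "f y \<noteq> f p"
    using assms(2,3) y(1,2) by (metis inj_onD)
  moreover have "\<not> separated_points Y (f p) (f y)"
  proof
    assume "separated_points Y (f p) (f y)"
    then obtain G H where GH: "openin Y G" "openin Y H" "f p \<in> G" "f y \<in> H" "disjnt G H"
      by (auto simp: separated_points_def)
    let ?G = "{x \<in> topspace X. f x \<in> G}" and ?H = "{x \<in> topspace X. f x \<in> H}"
    have "openin X ?G" "openin X ?H"
      using openin_continuous_map_preimage[OF assms(1)] GH by auto
    moreover have "p \<in> ?G" "y \<in> ?H" "disjnt ?G ?H"
      using GH y(1) assms(3) by (auto simp: disjnt_iff)
    ultimately have "separated_points X p y"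
      unfolding separated_points_def by blast
    with y(3) show False ..
  qed
  ultimately show ?thesis
    by (simp add: NH_def)
qed

theorem corollary4p14:
  fixes M :: "'a topology"
  assumes "one_manifold M" and "homogeneous_space M"
    and "\<exists>U. openin M U \<and> U \<noteq> {} \<and> Hausdorff_space (subtopology M U) \<and> f_rim_simple M U"
  shows "\<forall>p \<in> topspace M. subtopology M (NH M p) = discrete_topology (NH M p)"
proof
  fix p assume p: "p \<in> topspace M"
  obtain U u where U: "openin M U" "Hausdorff_space (subtopology M U)" "f_rim_simple M U"
      and u: "u \<in> U"
    using assms(3) by blast
  obtain f where f: "homeomorphic_map M M f" and fp: "f p = u"
    using assms(2) p u openin_subset[OF U(1)] unfolding homogeneous_space_def by blast
  have cont: "continuous_map M M f" and inj: "inj_on f (topspace M)"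
    using f by (auto simp: homeomorphic_imp_continuous_map homeomorphic_imp_injective_map)
  have sub: "NH M p \<subseteq> topspace M"
    by (auto simp: NH_def)
  have "openin (subtopology M (NH M p)) {q}" if q: "q \<in> NH M p" for q
  proof -
    have "f q \<in> NH M u"
      using NH_injective_image[OF cont inj p q] fp by simp
    then obtain W where W: "openin M W" "f q \<in> W" "W \<inter> NH M u \<subseteq> {f q}"
      using isolated_in_NH_of_point_of_f_rim_simple[OF assms(1) U u] by blast
    let ?V = "{x \<in> topspace M. f x \<in> W}"
    have "openin M ?V"
      using openin_continuous_map_preimage[OF cont W(1)] .
    moreover have "?V \<inter> NH M p = {q}"
    proof
      show "?V \<inter> NH M p \<subseteq> {q}"
      proof
        fix y assume y: "y \<in> ?V \<inter> NH M p"
        then have "f y \<in> NH M u"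
          using NH_injective_image[OF cont inj p] fp by force
        then have "f y = f q"
          using W(3) y by blast
        then show "y \<in> {q}"
          using inj y q sub by (auto dest: inj_onD)
      qed
      show "{q} \<subseteq> ?V \<inter> NH M p"
        using W(2) q sub by auto
    qed
    ultimately show ?thesis
      unfolding openin_subtopology by (intro exI[of _ ?V]) simp
  qed
  moreover have "topspace (subtopology M (NH M p)) = NH M p"
    using sub by (rule topspace_subtopology_subset)
  ultimately show "subtopology M (NH M p) = discrete_topology (NH M p)"
    using discrete_topology_unique[of "NH M p" "subtopology M (NH M p)"] by simp
qed

end
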